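(* Let $(X,\vartriangleright)$ be a rack with operator group $G\leq\mathrm{Sym}(X)$, and let $f:X\to\mathrm{Sym}(X)$ be the augmentation map of $(X,\vartriangleright)$. Let $\{\alpha_i:i\in I\}$ be a complete set of representatives for the orbits of $G$ on $X$ (exactly one $\alpha_i$ from each orbit, $I$ being an index set for the orbits), and define $\pi_i=\alpha_i f$ for $i\in I$. Then \[ C_G(\pi_i)\geq G_{\alpha_i}\quad\text{for all } i\in I, \] and \[ G=\langle g^{-1}\pi_i g: g\in G,\ i\in I\rangle. \] Moreover, $(\alpha_i g)f=g^{-1}\pi_i g$ for all $g\in G$ and $i\in I$, and $x\vartriangleright y=x(yf)$ for all $x,y\in X$.
   Context: A rack is a set $X$ together with a binary operation $\vartriangleright:X\times X\to X$ such that (i) for all $y\in X$ the map $f_y:X\to X$, $x\mapsto x\vartriangleright y$, is a bijection; and (ii) for all $x,y,z\in X$, $(x\vartriangleright y)\vartriangleright z=(x\vartriangleright z)\vartriangleright(y\vartriangleright z)$. Racks need not be finite. The augmentation map of $(X,\vartriangleright)$ is the map $f:X\to\mathrm{Sym}(X)$ defined by $(y)f=f_y$. The operator group of $(X,\vartriangleright)$ is the subgroup of $\mathrm{Sym}(X)$ generated by the image of $f$; it is a permutation group on $X$. $\mathrm{Sym}(X)$ is the symmetric group on $X$; permutations and maps are written on the right of their arguments and composed from left to right, so $x(gh)=(xg)h$. For a group $G\leq\mathrm{Sym}(X)$, $C_G(\pi)$ denotes the centraliser of $\pi\in G$ in $G$, and $G_\alpha$ denotes the point stabiliser of $\alpha\in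 X$ in $G$. *)

theory Defs
  imports "HOL-Algebra.Bij" "HOL-Algebra.Generated_Groups" "HOL-Algebra.Group_Action"
begin

locale rack =
  fixes X :: "'a set" and rack_op :: "'a \<Rightarrow> 'a \<Rightarrow> 'a"  (infixl "\<triangleright>" 70)
  assumes bij: "y \<in> X \<Longrightarrow> bij_betw (\<lambda>x. x \<triangleright> y) X X"
    and distrib: "\<lbrakk>x \<in> X; y \<in> X; z \<in> X\<rbrakk> \<Longrightarrow> (x \<triangleright> y) \<triangleright> z = (x \<triangleright> z) \<triangleright> (y \<triangleright> z)"

text \<open>
  Permutations act on the right and are composed from left to right, whereas
  \<^const>\<open>BijGroup\<close> composes from right to left; hence the multiplication is reversed.
\<close>

definition Sym :: "'a set \<Rightarrow> ('a \<Rightarrow> 'a) monoid"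
  where "Sym X = (BijGroup X) \<lparr>mult := \<lambda>g h. h \<otimes>\<^bsub>BijGroup X\<^esub> g\<rparr>"

lemma carrier_Sym: "carrier (Sym X) = Bij X"
  by (simp add: Sym_def BijGroup_def)

lemma mult_Sym_apply:
  "\<lbrakk>g \<in> carrier (Sym X); h \<in> carrier (Sym X); x \<in> X\<rbrakk> \<Longrightarrow> (g \<otimes>\<^bsub>Sym X\<^esub> h) x = h (g x)"
  by (simp add: Sym_def BijGroup_def compose_def)

lemma group_Sym: "group (Sym X)"
proof (rule groupI)
  interpret B: group "BijGroup X" by (rule group_BijGroup)
  fix g assume "g \<in> carrier (Sym X)"
  then show "\<exists>h\<in>carrier (Sym X). h \<otimes>\<^bsub>Sym X\<^esub> g = \<one>\<^bsub>Sym X\<^esub>"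
    using B.r_inv B.inv_closed by (auto simp: Sym_def)
qed (use group_BijGroup[of X] in \<open>auto simp: Sym_def group.is_monoid monoid.m_closed monoid.m_assoc\<close>)

definition augmentation_map :: "'a set \<Rightarrow> ('a \<Rightarrow> 'a \<Rightarrow> 'a) \<Rightarrow> 'a \<Rightarrow> ('a \<Rightarrow> 'a)"
  where "augmentation_map X rack_op = (\<lambda>y\<in>X. \<lambda>x\<in>X. rack_op x y)"

definition operator_group :: "'a set \<Rightarrow> ('a \<Rightarrow> 'a \<Rightarrow> 'a) \<Rightarrow> ('a \<Rightarrow> 'a) monoid"
  where "operator_group X rack_op =
    (Sym X) \<lparr>carrier := generate (Sym X) (augmentation_map X rack_op ` X)\<rparr>"

lemma (in rack) augmentation_map_in_Sym:
  "y \<in> X \<Longrightarrow> augmentation_map X rack_op y \<in> carrier (Sym X)"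
  using bij by (simp add: carrier_Sym Bij_def augmentation_map_def bij_betw_restrict_eq)

lemma (in rack) subgroup_operator_group:
  "subgroup (carrier (operator_group X rack_op)) (Sym X)"
  using augmentation_map_in_Sym
  by (auto simp: operator_group_def intro!: group.generate_is_subgroup[OF group_Sym])

definition centralizer :: "('a, 'b) monoid_scheme \<Rightarrow> 'a \<Rightarrow> 'a set"
  where "centralizer G p = {g \<in> carrier G. g \<otimes>\<^bsub>G\<^esub> p = p \<otimes>\<^bsub>G\<^esub> g}"

text \<open>
  A family of points of \<open>X\<close>, indexed by \<open>I\<close>, with exactly one member (and exactly one index)
  in each orbit of a group \<open>G\<close> of permutations of \<open>X\<close>.
\<close>

definition orbit_representatives ::
  "('a \<Rightarrow> 'a, 'b) monoid_scheme \<Rightarrow> 'a set \<Rightarrow> 'i set \<Rightarrow> ('i \<Rightarrow> 'a) \<Rightarrow> bool"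
  where "orbit_representatives G X I \<alpha> \<longleftrightarrow>
    \<alpha> \<in> I \<rightarrow> X \<and> (\<forall>O\<^sub>1 \<in> orbits G X (\<lambda>g. g). \<exists>!i. i \<in> I \<and> \<alpha> i \<in> O\<^sub>1)"

end

theory Submission
  imports Defs
begin

text \<open>
  The rack automorphisms form a subgroup of the symmetric group, and self-distributivity says that
  it contains the image of the augmentation map \<open>f\<close>, hence the operator group \<open>G\<close>.
  For an automorphism \<open>g\<close> one has \<open>(x \<triangleright> y)g = xg \<triangleright> yg\<close>, that is
  \<open>(yg)f = g\<inverse>(yf)g\<close>. If \<open>g\<close> fixes \<open>y\<close> then it centralises \<open>yf\<close>,
  and as every point of \<open>X\<close> has the form \<open>\<alpha>\<^sub>ig\<close>, the conjugates of the
  \<open>\<pi>\<^sub>i\<close> are exactly the elements of the image of \<open>f\<close>.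
\<close>

lemma one_Sym_apply: "x \<in> X \<Longrightarrow> \<one>\<^bsub>Sym X\<^esub> x = x"
  by (simp add: Sym_def BijGroup_def)

lemma Sym_closed: "\<lbrakk>g \<in> carrier (Sym X); x \<in> X\<rbrakk> \<Longrightarrow> g x \<in> X"
  by (auto simp: carrier_Sym Bij_def bij_betw_def)

text \<open>Elements of \<open>Bij X\<close> are extensional: off \<open>X\<close> they all take the
  value \<open>undefined\<close>, so only their values on \<open>X\<close> can differ.\<close>

lemma Sym_eqI:
  assumes "g \<in> carrier (Sym X)" "h \<in> carrier (Sym X)" "\<And>x. x \<in> X \<Longrightarrow> g x = h x"
  shows "g = h"
  using assms by (auto simp: carrier_Sym Bij_def intro: extensionalityI)

lemma inv_Sym_apply_left:
  assumes "g \<in> carrier (Sym X)" "x \<in> X"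
  shows "(inv\<^bsub>Sym X\<^esub> g) (g x) = x"
proof -
  interpret group "Sym X" by (rule group_Sym)
  show ?thesis
    using assms mult_Sym_apply[of g X "inv\<^bsub>Sym X\<^esub> g" x] by (simp add: one_Sym_apply)
qed

lemma inv_Sym_apply_right:
  assumes "g \<in> carrier (Sym X)" "x \<in> X"
  shows "g ((inv\<^bsub>Sym X\<^esub> g) x) = x"
proof -
  interpret group "Sym X" by (rule group_Sym)
  show ?thesis
    using assms mult_Sym_apply[of "inv\<^bsub>Sym X\<^esub> g" X g x] by (simp add: one_Sym_apply)
qed

text \<open>Because the multiplication is reversed, the identity map from \<open>Sym X\<close> to
  \<open>BijGroup X\<close> is an antihomomorphism and no \<open>group_action\<close>; closure is
  therefore checked by evaluating at \<open>a\<close>.\<close>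

lemma subgroup_stabilizer_Sym:
  assumes H: "subgroup H (Sym X)" and a: "a \<in> X"
  shows "subgroup (stabilizer ((Sym X)\<lparr>carrier := H\<rparr>) (\<lambda>g. g) a) (Sym X)"
proof -
  interpret group "Sym X" by (rule group_Sym)
  interpret H: subgroup H "Sym X" by (rule H)
  have inv_fix: "(inv\<^bsub>Sym X\<^esub> g) a = a" if "g \<in> H" "g a = a" for g
    using inv_Sym_apply_left[of g X a] that a by (simp add: H.mem_carrier)
  show ?thesis
    by (rule subgroupI)
      (use a inv_fix in \<open>auto simp: stabilizer_def mult_Sym_apply one_Sym_apply
        intro!: exI[of _ "\<one>\<^bsub>Sym X\<^esub>"]\<close>)
qed

lemma (in group) subgroup_centralizer:
  assumes "p \<in> carrier G"
  shows "subgroup (centralizer G p) G"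
proof (rule subgroupI)
  show "centralizer G p \<noteq> {}"
    using assms by (auto simp: centralizer_def intro!: exI[of _ \<one>])
next
  fix g assume "g \<in> centralizer G p"
  then have g: "g \<in> carrier G" "g \<otimes> p = p \<otimes> g"
    by (auto simp: centralizer_def)
  have "inv g \<otimes> p = inv g \<otimes> (p \<otimes> g) \<otimes> inv g"
    using assms g by (simp add: m_assoc)
  also have "\<dots> = inv g \<otimes> (g \<otimes> p) \<otimes> inv g"
    using g by simp
  also have "\<dots> = p \<otimes> inv g"
    using assms g(1) by (simp flip: m_assoc)
  finally show "inv g \<in> centralizer G p"
    using g by (simp add: centralizer_def)
next
  fix g h assume "g \<in> centralizer G p" "h \<in> centralizer G p"
  then show "g \<otimes> h \<in> centralizer G p"
    using assms by (auto simp: centralizer_def m_assoc) (simp flip: m_assoc)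
qed (auto simp: centralizer_def)

context rack
begin

lemma rack_op_closed: "\<lbrakk>x \<in> X; y \<in> X\<rbrakk> \<Longrightarrow> x \<triangleright> y \<in> X"
  using bij by (auto simp: bij_betw_def)

lemma augmentation_map_apply: "\<lbrakk>x \<in> X; y \<in> X\<rbrakk> \<Longrightarrow> augmentation_map X (\<triangleright>) y x = x \<triangleright> y"
  by (simp add: augmentation_map_def)

definition automorphisms :: "('a \<Rightarrow> 'a) set"
  where "automorphisms =
    {g \<in> carrier (Sym X). \<forall>x\<in>X. \<forall>y\<in>X. g (x \<triangleright> y) = g x \<triangleright> g y}"

lemma subgroup_automorphisms: "subgroup automorphisms (Sym X)"
proof -
  interpret group "Sym X" by (rule group_Sym)
  show ?thesis
  proof (rule subgroupI)
    show "automorphisms \<noteq> {}"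
      by (auto simp: automorphisms_def one_Sym_apply rack_op_closed intro!: exI[of _ "\<one>\<^bsub>Sym X\<^esub>"])
  next
    fix g assume "g \<in> automorphisms"
    then have g: "g \<in> carrier (Sym X)"
      and hom: "\<And>x y. x \<in> X \<Longrightarrow> y \<in> X \<Longrightarrow> g (x \<triangleright> y) = g x \<triangleright> g y"
      by (auto simp: automorphisms_def)
    let ?h = "inv\<^bsub>Sym X\<^esub> g"
    have h: "?h \<in> carrier (Sym X)"
      using g by simp
    have "?h (x \<triangleright> y) = ?h x \<triangleright> ?h y" if "x \<in> X" "y \<in> X" for x y
    proof -
      have xy: "?h x \<in> X" "?h y \<in> X"
        using Sym_closed[OF h] that by auto
      \<comment> \<open>Both arguments are written as images under \<open>g\<close> of their
        preimages, so that \<open>hom\<close> can be read backwards.\<close>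
      have "?h (x \<triangleright> y) = ?h (g (?h x \<triangleright> ?h y))"
        using hom[OF xy] that g by (simp add: inv_Sym_apply_right)
      also have "\<dots> = ?h x \<triangleright> ?h y"
        using g xy by (simp add: inv_Sym_apply_left rack_op_closed)
      finally show ?thesis .
    qed
    then show "?h \<in> automorphisms"
      using h by (simp add: automorphisms_def)
  qed (auto simp: automorphisms_def mult_Sym_apply rack_op_closed Sym_closed)
qed

lemma augmentation_map_automorphism:
  "y \<in> X \<Longrightarrow> augmentation_map X (\<triangleright>) y \<in> automorphisms"
  unfolding automorphisms_def
  by (intro CollectI conjI ballI augmentation_map_in_Sym)
    \<comment> \<open>Fixing \<open>z\<close> makes self-distributivity a terminating rule: with
      \<open>z\<close> free, its right-hand side is again an instance of its left-hand side.\<close>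
    (simp_all only: augmentation_map_apply rack_op_closed distrib[where z = y])

text \<open>A generated subgroup lies in every subgroup that contains its generators, which replaces
  an induction over words in the generators.\<close>

lemma operator_group_automorphisms: "carrier (operator_group X (\<triangleright>)) \<subseteq> automorphisms"
proof -
  interpret group "Sym X" by (rule group_Sym)
  show ?thesis
    using generate_subgroup_incl[OF _ subgroup_automorphisms] augmentation_map_automorphism
    by (simp add: operator_group_def image_subset_iff)
qed

text \<open>Acting from left to right, both products send \<open>x\<close> to
  \<open>g x \<triangleright> g y = g (x \<triangleright> y)\<close>. This form without inverses
  serves two ends: it gives the conjugation formula, and for \<open>g y = y\<close> it says that
  \<open>g\<close> centralises the image of \<open>y\<close>.\<close>

lemma augmentation_map_equivariant:
  assumes g: "g \<in> automorphisms" and y: "y \<in> X"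
  shows "g \<otimes>\<^bsub>Sym X\<^esub> augmentation_map X (\<triangleright>) (g y) = augmentation_map X (\<triangleright>) y \<otimes>\<^bsub>Sym X\<^esub> g"
proof -
  interpret group "Sym X" by (rule group_Sym)
  have gS: "g \<in> carrier (Sym X)"
    using g by (simp add: automorphisms_def)
  have fS: "augmentation_map X (\<triangleright>) y \<in> carrier (Sym X)"
    "augmentation_map X (\<triangleright>) (g y) \<in> carrier (Sym X)"
    using augmentation_map_in_Sym Sym_closed[OF gS] y by auto
  show ?thesis
  proof (rule Sym_eqI)
    fix x assume "x \<in> X"
    then show "(g \<otimes>\<^bsub>Sym X\<^esub> augmentation_map X (\<triangleright>) (g y)) x
        = (augmentation_map X (\<triangleright>) y \<otimes>\<^bsub>Sym X\<^esub> g) x"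
      using g y gS fS
      by (simp add: mult_Sym_apply augmentation_map_apply Sym_closed automorphisms_def)
  qed (use gS fS in auto)
qed

lemma augmentation_map_conjugate:
  assumes g: "g \<in> automorphisms" and y: "y \<in> X"
  shows "augmentation_map X (\<triangleright>) (g y)
    = inv\<^bsub>Sym X\<^esub> g \<otimes>\<^bsub>Sym X\<^esub> augmentation_map X (\<triangleright>) y \<otimes>\<^bsub>Sym X\<^esub> g"
proof -
  interpret group "Sym X" by (rule group_Sym)
  have gS: "g \<in> carrier (Sym X)"
    using g by (simp add: automorphisms_def)
  have "augmentation_map X (\<triangleright>) y \<in> carrier (Sym X)"
    "augmentation_map X (\<triangleright>) (g y) \<in> carrier (Sym X)"
    using augmentation_map_in_Sym Sym_closed[OF gS] y by auto
  then show ?thesis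
    using gS augmentation_map_equivariant[OF g y, symmetric]
    \<comment> \<open>Bracketing to the right exposes the product that equivariance rewrites;
      bracketing to the left then lets \<open>g\<close> cancel against its inverse.\<close>
    by (simp add: m_assoc) (simp flip: m_assoc)
qed

end

theorem theorem4:
  fixes X :: "'a set" and rack_op :: "'a \<Rightarrow> 'a \<Rightarrow> 'a"  (infixl "\<triangleright>" 70)
    and G :: "('a \<Rightarrow> 'a) monoid" and f :: "'a \<Rightarrow> ('a \<Rightarrow> 'a)"
    and I :: "'i set" and \<alpha> :: "'i \<Rightarrow> 'a" and \<pi> :: "'i \<Rightarrow> ('a \<Rightarrow> 'a)"
  assumes "rack X (\<triangleright>)"
    and "G = operator_group X (\<triangleright>)"
    and "f = augmentation_map X (\<triangleright>)"
    and "orbit_representatives G X I \<alpha>"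
    and "\<And>i. i \<in> I \<Longrightarrow> \<pi> i = f (\<alpha> i)"
  shows "(\<forall>i\<in>I. subgroup (stabilizer G (\<lambda>g. g) (\<alpha> i)) (G\<lparr>carrier := centralizer G (\<pi> i)\<rparr>))
    \<and> carrier G = generate (Sym X)
        {inv\<^bsub>Sym X\<^esub> g \<otimes>\<^bsub>Sym X\<^esub> \<pi> i \<otimes>\<^bsub>Sym X\<^esub> g | g i. g \<in> carrier G \<and> i \<in> I}
    \<and> (\<forall>g\<in>carrier G. \<forall>i\<in>I. f (g (\<alpha> i)) = inv\<^bsub>Sym X\<^esub> g \<otimes>\<^bsub>Sym X\<^esub> \<pi> i \<otimes>\<^bsub>Sym X\<^esub> g)
    \<and> (\<forall>x\<in>X. \<forall>y\<in>X. x \<triangleright> y = f y x)"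
proof -
  interpret rack X "(\<triangleright>)" by fact
  interpret S: group "Sym X" by (rule group_Sym)
  have H: "subgroup (carrier G) (Sym X)"
    unfolding assms(2) by (rule subgroup_operator_group)
  have G: "(Sym X)\<lparr>carrier := carrier G\<rparr> = G"
    by (simp add: assms(2) operator_group_def)
  have mult_G: "(\<otimes>\<^bsub>G\<^esub>) = (\<otimes>\<^bsub>Sym X\<^esub>)"
    by (simp add: assms(2) operator_group_def)
  have group_G: "group G"
    using subgroup.subgroup_is_group[OF H S.group_axioms] by (simp only: G)
  have aut: "g \<in> automorphisms" if "g \<in> carrier G" for g
    using that operator_group_automorphisms assms(2) by auto
  have GS: "g \<in> carrier (Sym X)" if "g \<in> carrier G" for g
    using that H by (rule subgroup.mem_carrier[rotated])
  have \<alpha>: "\<alpha> i \<in> X" if "i \<in> I" for i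
    using assms(4) that by (auto simp: orbit_representatives_def)
  have f_in_G: "f x \<in> carrier G" if "x \<in> X" for x
    using that by (auto simp: assms(2,3) operator_group_def intro: generate.incl)
  have conj: "f (g (\<alpha> i)) = inv\<^bsub>Sym X\<^esub> g \<otimes>\<^bsub>Sym X\<^esub> \<pi> i \<otimes>\<^bsub>Sym X\<^esub> g"
    if "g \<in> carrier G" "i \<in> I" for g i
    using augmentation_map_conjugate[OF aut \<alpha>] that assms(3,5) by simp
  have reach: "\<exists>g\<in>carrier G. \<exists>i\<in>I. x = g (\<alpha> i)" if x: "x \<in> X" for x
  proof -
    have "orbit G (\<lambda>g. g) x \<in> orbits G X (\<lambda>g. g)"
      using x by (auto simp: orbits_def)
    then obtain i where i: "i \<in> I" "\<alpha> i \<in> orbit G (\<lambda>g. g) x"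
      using assms(4) by (auto simp: orbit_representatives_def)
    then obtain g where g: "g \<in> carrier G" "\<alpha> i = g x"
      by (auto simp: orbit_def)
    \<comment> \<open>The orbit of \<open>x\<close> supplies a \<open>g\<close> that carries
      \<open>x\<close> to the representative, so the element sought is its inverse.\<close>
    then have "x = (inv\<^bsub>Sym X\<^esub> g) (\<alpha> i)"
      using x GS by (simp add: inv_Sym_apply_left)
    then show ?thesis
      using i g subgroup.m_inv_closed[OF H] by blast
  qed
  \<comment> \<open>The two generating sets coincide as sets, so the groups they generate need no
    separate comparison.\<close>
  have image: "f ` X = {inv\<^bsub>Sym X\<^esub> g \<otimes>\<^bsub>Sym X\<^esub> \<pi> i \<otimes>\<^bsub>Sym X\<^esub> g | g i. g \<in> carrier G \<and> i \<in> I}"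
    (is "_ = ?C")
  proof
    show "f ` X \<subseteq> ?C"
      using reach conj by blast
    show "?C \<subseteq> f ` X"
      using conj \<alpha> GS by (auto simp: Sym_closed simp flip: conj)
  qed
  have "carrier G = generate (Sym X) (f ` X)"
    by (simp add: assms(2,3) operator_group_def)
  then have gen: "carrier G = generate (Sym X) ?C"
    by (simp only: image)
  have stab: "subgroup (stabilizer G (\<lambda>g. g) (\<alpha> i)) (G\<lparr>carrier := centralizer G (\<pi> i)\<rparr>)"
    if i: "i \<in> I" for i
  \<comment> \<open>Two subgroups of \<open>G\<close>, one contained in the other as a set: this
    makes the smaller a subgroup of the larger.\<close>
  proof (rule group.subgroup_incl[OF group_G])
    have "subgroup (stabilizer G (\<lambda>g. g) (\<alpha> i)) (Sym X)"
      using subgroup_stabilizer_Sym[OF H \<alpha>[OF i]] by (simp only: G)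
    then have "subgroup (stabilizer G (\<lambda>g. g) (\<alpha> i)) ((Sym X)\<lparr>carrier := carrier G\<rparr>)"
      using H by (rule S.subgroup_incl) (auto simp: stabilizer_def)
    then show "subgroup (stabilizer G (\<lambda>g. g) (\<alpha> i)) G"
      by (simp only: G)
    show "subgroup (centralizer G (\<pi> i)) G"
      using f_in_G[OF \<alpha>[OF i]] assms(5)[OF i]
      by (intro group.subgroup_centralizer[OF group_G]) simp
    show "stabilizer G (\<lambda>g. g) (\<alpha> i) \<subseteq> centralizer G (\<pi> i)"
    proof
      fix g assume "g \<in> stabilizer G (\<lambda>g. g) (\<alpha> i)"
      then have g: "g \<in> carrier G" "g (\<alpha> i) = \<alpha> i"
        by (auto simp: stabilizer_def)
      \<comment> \<open>As \<open>g\<close> fixes \<open>\<alpha> i\<close>, both augmentation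
        values in the equivariance identity are \<open>\<pi> i\<close>.\<close>
      then show "g \<in> centralizer G (\<pi> i)"
        using augmentation_map_equivariant[OF aut[OF g(1)] \<alpha>[OF i]] assms(3) assms(5)[OF i]
        by (simp add: centralizer_def mult_G)
    qed
  qed
  have "x \<triangleright> y = f y x" if "x \<in> X" "y \<in> X" for x y
    using that by (simp add: assms(3) augmentation_map_apply)
  then show ?thesis
    using stab gen conj by blast
qed

end
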